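(* $\mathbf L=\operatorname{var} S(xzxyty)$, i.e. the monoid variety $\mathbf L$ is generated by the monoid $S(xzxyty)$.
   Context: Monoids are algebras of type $(2,0)$ (associative multiplication and the constant $1$). $F^1$ is the free monoid over a countably infinite alphabet, with empty word $\lambda$ as identity. $\operatorname{var}\Sigma$ is the variety of all monoids satisfying the identity system $\Sigma$; $\operatorname{var}M$ is the monoid variety generated by a monoid $M$. For a word $\mathbf w$, let $\overline{\{\mathbf w\}}$ be the set of all (contiguous, possibly empty) subwords of $\mathbf w$; $I=F^1\setminus\overline{\{\mathbf w\}}$ is an ideal of $F^1$, and $S(\mathbf w)=F^1/I$ is the Rees quotient monoid. $\sigma_1$ is $xyzxty\approx yxzxty$ and $\sigma_2$ is $xtyzxy\approx xtyzyx$. For $n\in\mathbb N$ and $\pi,\tau\in S_n$ put $$\mathbf w_n(\pi,\tau)=\Bigl(\prod_{i=1}^n z_it_i\Bigr)x\Bigl(\prod_{i=1}^n z_{\pi(i)}z_{n+\tau(i)}\Bigr)x\Bigl(\prod_{i=n+1}^{2n}t_iz_i\Bigr),$$ $$\mathbf w_n'(\pi,\tau)=\Bigl(\prod_{i=1}^n z_it_i\Bigr)x^2\Bigl(\prod_{i=1}^n z_{\pi(i)}z_{n+\tau(i)}\Bigr)\Bigl(\prod_{i=n+1}^{2n}t_iz_i\Bigr)$$ (products in increasing order of $i$). Then $\mathbf L=\operatorname{var}\{x^2y\approx yx^2,\ xyxzx\approx x^2yz,\ \sigma_1,\ \sigma_2,\ \mathbf w_n(\pi,\tau)\approx\mathbf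 w_n'(\pi,\tau)\mid n\in\mathbb N,\ \pi,\tau\in S_n\}$. *)

theory Defs
  imports "HOL-Algebra.Product_Groups" "HOL-Combinatorics.Permutations" "HOL-Library.Sublist"
begin

text \<open>
  Letters: \<open>X\<close>, \<open>Y\<close>, \<open>Z i\<close>, \<open>T i\<close> stand for \<open>x\<close>, \<open>y\<close>, \<open>z\<^sub>i\<close>, \<open>t\<^sub>i\<close>; the unindexed letters \<open>z\<close> and
  \<open>t\<close> are \<open>Z 0\<close> and \<open>T 0\<close>. Together they form the countably infinite alphabet.
\<close>

datatype letter = X | Y | Z nat | T nat

type_synonym word = "letter list"

definition free_monoid :: "word monoid" where
  "free_monoid = \<lparr>carrier = UNIV, monoid.mult = (@), one = []\<rparr>"


section \<open>Identities and equational classes\<close>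

definition eval_word :: "('a, 'b) monoid_scheme \<Rightarrow> (letter \<Rightarrow> 'a) \<Rightarrow> word \<Rightarrow> 'a" where
  "eval_word M \<phi> w = foldr (\<lambda>a r. \<phi> a \<otimes>\<^bsub>M\<^esub> r) w \<one>\<^bsub>M\<^esub>"

text \<open>An identity \<open>u \<approx> v\<close> is the pair \<open>(u, v)\<close>.\<close>

definition satisfies :: "('a, 'b) monoid_scheme \<Rightarrow> word \<times> word \<Rightarrow> bool" where
  "satisfies M e \<longleftrightarrow>
     (\<forall>\<phi>. range \<phi> \<subseteq> carrier M \<longrightarrow> eval_word M \<phi> (fst e) = eval_word M \<phi> (snd e))"

definition var_identities :: "(word \<times> word) set \<Rightarrow> 'a monoid set" where
  "var_identities \<Sigma> = {M. monoid M \<and> (\<forall>e\<in>\<Sigma>. satisfies M e)}"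


section \<open>The variety generated by a monoid\<close>

text \<open>
  \<open>N\<close> is a homomorphic image of a submonoid of the direct power \<open>M\<^sup>I\<close>. Despite its name,
  \<^const>\<open>product_group\<close> is the componentwise product of arbitrary monoid records.
\<close>

definition image_of_submonoid_of_power ::
    "'i set \<Rightarrow> 'm monoid \<Rightarrow> 'a monoid \<Rightarrow> bool" where
  "image_of_submonoid_of_power I M N \<longleftrightarrow>
     (\<exists>H h. submonoid H (product_group I (\<lambda>_. M)) \<and>
            h \<in> epi ((product_group I (\<lambda>_. M))\<lparr>carrier := H\<rparr>) N \<and>
            h \<one>\<^bsub>product_group I (\<lambda>_. M)\<^esub> = \<one>\<^bsub>N\<^esub>)"

text \<open>
  The variety generated by \<open>M\<close> is the class \<open>HSP(M)\<close>. Since a formula cannot quantify over the type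
  of the index set, \<open>I\<close> ranges over the subsets of \<open>'a \<Rightarrow> 'm\<close>; the lemma below shows that an index set
  of any other type yields nothing new.
\<close>

definition var_monoid :: "'m monoid \<Rightarrow> 'a monoid set" where
  "var_monoid M =
     {N. monoid N \<and> (\<exists>I :: ('a \<Rightarrow> 'm) set. image_of_submonoid_of_power I M N)}"

lemma var_monoid_any_index_type:
  fixes I :: "'i set" and M :: "'m monoid" and N :: "'a monoid"
  assumes M: "monoid M" and N: "monoid N" and img: "image_of_submonoid_of_power I M N"
  shows "N \<in> var_monoid M"
proof -
  let ?P = "product_group I (\<lambda>_. M)"
  obtain H h where sub: "submonoid H ?P" and h: "h \<in> epi (?P\<lparr>carrier := H\<rparr>) N"
    and h1: "h \<one>\<^bsub>?P\<^esub> = \<one>\<^bsub>N\<^esub>"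
    using img unfolding image_of_submonoid_of_power_def by blast
  interpret H: submonoid H ?P by (rule sub)
  have hmult: "h (f \<otimes>\<^bsub>?P\<^esub> g) = h f \<otimes>\<^bsub>N\<^esub> h g" if "f \<in> H" "g \<in> H" for f g
    using h that by (auto simp: epi_def hom_def)
  have hsurj: "h ` H = carrier N"
    using h by (auto simp: epi_def)
  define s where "s n = inv_into H h n" for n
  have s: "s n \<in> H \<and> h (s n) = n" if "n \<in> carrier N" for n
    using that unfolding s_def hsurj[symmetric] by (simp add: inv_into_into f_inv_into_f)
  define c where "c i = (\<lambda>n. if n \<in> carrier N then s n i else \<one>\<^bsub>M\<^esub>)" for i
  define J where "J = c ` I"
  let ?Q = "product_group J (\<lambda>_. M)"
  define r where "r f = (\<lambda>i\<in>I. f (c i))" for f :: "('a \<Rightarrow> 'm) \<Rightarrow> 'm"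
  define K where "K = {f \<in> carrier ?Q. r f \<in> H}"
  have cJ: "c i \<in> J" if "i \<in> I" for i
    using that by (simp add: J_def)
  have r_mult: "r (f \<otimes>\<^bsub>?Q\<^esub> g) = r f \<otimes>\<^bsub>?P\<^esub> r g" for f g
    by (auto simp: r_def cJ)
  have r_one: "r \<one>\<^bsub>?Q\<^esub> = \<one>\<^bsub>?P\<^esub>"
    by (auto simp: r_def cJ)
  have "submonoid K ?Q"
  proof
    show "K \<subseteq> carrier ?Q"
      by (auto simp: K_def)
    show "f \<otimes>\<^bsub>?Q\<^esub> g \<in> K" if "f \<in> K" "g \<in> K" for f g
    proof -
      have "f \<otimes>\<^bsub>?Q\<^esub> g \<in> carrier ?Q"
        using that M by (auto simp: K_def PiE_iff intro!: monoid.m_closed)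
      moreover have "r (f \<otimes>\<^bsub>?Q\<^esub> g) \<in> H"
        unfolding r_mult by (rule H.m_closed) (use that in \<open>auto simp: K_def\<close>)
      ultimately show ?thesis
        by (simp only: K_def mem_Collect_eq)
    qed
    show "\<one>\<^bsub>?Q\<^esub> \<in> K"
      using M H.one_closed r_one by (auto simp: K_def monoid.one_closed)
  qed
  moreover have "h \<circ> r \<in> epi (?Q\<lparr>carrier := K\<rparr>) N"
  proof -
    have "(h \<circ> r) ` K \<subseteq> carrier N"
      using hsurj by (auto simp: K_def)
    moreover have "n \<in> (h \<circ> r) ` K" if n: "n \<in> carrier N" for n
    proof
      let ?f = "\<lambda>j\<in>J. j n"
      have sn: "s n \<in> carrier ?P"
        using s n H.subset by blast
      have cn: "c i n = s n i" for i
        using n by (simp add: c_def)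
      have "r ?f = s n"
      proof
        show "r ?f i = s n i" for i
          using sn by (cases "i \<in> I") (simp_all add: r_def cJ cn PiE_iff extensional_def)
      qed
      moreover have "?f \<in> carrier ?Q"
        using sn by (auto simp: J_def cn PiE_iff)
      ultimately show "?f \<in> K" "n = (h \<circ> r) ?f"
        using s n by (simp_all add: K_def)
    qed
    ultimately have "(h \<circ> r) ` K = carrier N"
      by blast
    moreover have "(h \<circ> r) (f \<otimes>\<^bsub>?Q\<^esub> g) = (h \<circ> r) f \<otimes>\<^bsub>N\<^esub> (h \<circ> r) g" if "f \<in> K" "g \<in> K" for f g
      using that hmult unfolding comp_def r_mult by (simp only: K_def mem_Collect_eq)
    ultimately show ?thesis
      unfolding epi_def hom_def by auto
  qed
  moreover have "(h \<circ> r) \<one>\<^bsub>?Q\<^esub> = \<one>\<^bsub>N\<^esub>"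
    using h1 unfolding comp_def r_one .
  ultimately have "image_of_submonoid_of_power J M N"
    unfolding image_of_submonoid_of_power_def by blast
  with N show ?thesis
    unfolding var_monoid_def by blast
qed


section \<open>Rees quotients and \<open>S(w)\<close>\<close>

definition rees_congruence :: "('a, 'b) monoid_scheme \<Rightarrow> 'a set \<Rightarrow> ('a \<times> 'a) set" where
  "rees_congruence G I =
     {(a, b). a \<in> carrier G \<and> b \<in> carrier G \<and> (a = b \<or> a \<in> I \<and> b \<in> I)}"

definition rees_quotient :: "('a, 'b) monoid_scheme \<Rightarrow> 'a set \<Rightarrow> 'a set monoid" where
  "rees_quotient G I =
     \<lparr>carrier = carrier G // rees_congruence G I,
      monoid.mult = (\<lambda>A B. \<Union>a\<in>A. \<Union>b\<in>B. rees_congruence G I `` {a \<otimes>\<^bsub>G\<^esub> b}),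
      one = rees_congruence G I `` {\<one>\<^bsub>G\<^esub>}\<rparr>"

definition S_monoid :: "word \<Rightarrow> word set monoid" where
  "S_monoid w = rees_quotient free_monoid (carrier free_monoid - {u. sublist u w})"


section \<open>The variety \<open>L\<close>\<close>

definition sigma1 :: "word \<times> word" where
  "sigma1 = ([X, Y, Z 0, X, T 0, Y], [Y, X, Z 0, X, T 0, Y])"

definition sigma2 :: "word \<times> word" where
  "sigma2 = ([X, T 0, Y, Z 0, X, Y], [X, T 0, Y, Z 0, Y, X])"

definition w_word :: "nat \<Rightarrow> (nat \<Rightarrow> nat) \<Rightarrow> (nat \<Rightarrow> nat) \<Rightarrow> word" where
  "w_word n \<pi> \<tau> =
     concat (map (\<lambda>i. [Z i, T i]) [1..<n + 1]) @ [X] @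
     concat (map (\<lambda>i. [Z (\<pi> i), Z (n + \<tau> i)]) [1..<n + 1]) @ [X] @
     concat (map (\<lambda>i. [T i, Z i]) [n + 1..<2 * n + 1])"

definition w_word' :: "nat \<Rightarrow> (nat \<Rightarrow> nat) \<Rightarrow> (nat \<Rightarrow> nat) \<Rightarrow> word" where
  "w_word' n \<pi> \<tau> =
     concat (map (\<lambda>i. [Z i, T i]) [1..<n + 1]) @ [X, X] @
     concat (map (\<lambda>i. [Z (\<pi> i), Z (n + \<tau> i)]) [1..<n + 1]) @
     concat (map (\<lambda>i. [T i, Z i]) [n + 1..<2 * n + 1])"

definition L_identities :: "(word \<times> word) set" where
  "L_identities =
     {([X, X, Y], [Y, X, X]), ([X, Y, X, Z 0, X], [X, X, Y, Z 0]), sigma1, sigma2} \<union>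
     {(w_word n \<pi> \<tau>, w_word' n \<pi> \<tau>) | n \<pi> \<tau>. \<pi> permutes {1..n} \<and> \<tau> permutes {1..n}}"

definition L_variety :: "'a monoid set" where
  "L_variety = var_identities L_identities"

end

theory Submission
  imports Defs
begin

text \<open>
  By Birkhoff's theorem it suffices that an identity \<open>u \<approx> v\<close> of \<open>S(xzxyty)\<close> is a consequence of the
  identities of \<open>L\<close>. Call a repeated letter \<open>x\<close> split if \<open>x\<close> occurs twice with a simple letter (one
  that occurs once) in between. By the identities \<open>w\<^sub>n \<approx> w\<^sub>n'\<close>, \<open>x\<^sup>2y \<approx> yx\<^sup>2\<close> and \<open>xyxzx \<approx> x\<^sup>2yz\<close> all
  occurrences of a repeated letter that is not split can be collected to a factor \<open>x\<^sup>2\<close> in front. The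
  same letters are unsplit in \<open>u\<close> and in \<open>v\<close>, so they can be cancelled by induction. If every repeated
  letter is split, then all that \<open>S(xzxyty)\<close> leaves undetermined is the order of adjacent first
  occurrences and of adjacent second occurrences; \<open>\<sigma>\<^sub>1\<close> and \<open>\<sigma>\<^sub>2\<close> allow \<open>u\<close> to be sorted into \<open>v\<close>.
\<close>

section \<open>Evaluation of words\<close>

text \<open>A version of \<open>eval_word\<close> over an arbitrary alphabet: in Birkhoff's argument
  the elements of a monoid themselves serve as letters.\<close>

definition eval_list :: "('m, 'c) monoid_scheme \<Rightarrow> ('b \<Rightarrow> 'm) \<Rightarrow> 'b list \<Rightarrow> 'm" where
  "eval_list M \<phi> w = foldr (\<lambda>a r. \<phi> a \<otimes>\<^bsub>M\<^esub> r) w \<one>\<^bsub>M\<^esub>"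

lemma eval_list_simps [simp]:
  "eval_list M \<phi> [] = \<one>\<^bsub>M\<^esub>"
  "eval_list M \<phi> (a # w) = \<phi> a \<otimes>\<^bsub>M\<^esub> eval_list M \<phi> w"
  by (simp_all add: eval_list_def)

lemma eval_word_eq_eval_list: "eval_word = eval_list"
  by (intro ext) (simp add: eval_word_def eval_list_def)

lemma eval_list_map: "eval_list M \<phi> (map e w) = eval_list M (\<lambda>a. \<phi> (e a)) w"
  by (induction w) auto

lemma eval_list_cong:
  "(\<And>a. a \<in> set w \<Longrightarrow> \<phi> a = \<psi> a) \<Longrightarrow> eval_list M \<phi> w = eval_list M \<psi> w"
  by (induction w) auto

context monoid
begin

lemma eval_list_closed [simp]:
  "\<phi> ` set w \<subseteq> carrier G \<Longrightarrow> eval_list G \<phi> w \<in> carrier G"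
  by (induction w) auto

lemma eval_list_append:
  "\<phi> ` set u \<subseteq> carrier G \<Longrightarrow> \<phi> ` set v \<subseteq> carrier G \<Longrightarrow>
     eval_list G \<phi> (u @ v) = eval_list G \<phi> u \<otimes> eval_list G \<phi> v"
  by (induction u) (auto simp: m_assoc)

end

lemma monoid_product_group:
  assumes "monoid M"
  shows "monoid (product_group I (\<lambda>_. M))"
proof -
  interpret M: monoid M by fact
  show ?thesis
    by unfold_locales
      (auto simp: PiE_iff extensional_def fun_eq_iff M.m_assoc restrict_def intro!: ext)
qed

lemma eval_list_product_group:
  assumes "i \<in> I"
  shows "eval_list (product_group I (\<lambda>_. M)) \<phi> w i = eval_list M (\<lambda>a. \<phi> a i) w"
  using assms by (induction w) auto

section \<open>Birkhoff's theorem for the variety generated by a monoid\<close>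

text \<open>An identity holds in a power coordinate by coordinate, and it passes to the image
  because every assignment into \<open>N\<close> lifts along the surjection to one into
  \<open>H\<close>.\<close>

lemma satisfies_image_of_submonoid_of_power:
  fixes M :: "'m monoid" and N :: "'a monoid"
  assumes M: "monoid M" and N: "monoid N"
    and img: "image_of_submonoid_of_power I M N" and sat: "satisfies M e"
  shows "satisfies N e"
  unfolding satisfies_def eval_word_eq_eval_list
proof (intro allI impI)
  fix \<phi> :: "letter \<Rightarrow> 'a"
  assume \<phi>: "range \<phi> \<subseteq> carrier N"
  let ?P = "product_group I (\<lambda>_. M)"
  obtain H h where sub: "submonoid H ?P" and h: "h \<in> epi (?P\<lparr>carrier := H\<rparr>) N"
    and h1: "h \<one>\<^bsub>?P\<^esub> = \<one>\<^bsub>N\<^esub>"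
    using img unfolding image_of_submonoid_of_power_def by blast
  interpret P: monoid ?P by (rule monoid_product_group[OF M])
  interpret H: submonoid H ?P by (rule sub)
  have hmult: "h (f \<otimes>\<^bsub>?P\<^esub> g) = h f \<otimes>\<^bsub>N\<^esub> h g" if "f \<in> H" "g \<in> H" for f g
    using h that by (auto simp: epi_def hom_def)
  have hsurj: "h ` H = carrier N"
    using h by (auto simp: epi_def)
  define \<psi> where "\<psi> l = inv_into H h (\<phi> l)" for l
  have \<psi>: "\<psi> l \<in> H" "h (\<psi> l) = \<phi> l" for l
  proof -
    have "\<phi> l \<in> h ` H" using \<phi> hsurj by auto
    then show "\<psi> l \<in> H" "h (\<psi> l) = \<phi> l"
      unfolding \<psi>_def by (rule inv_into_into, rule f_inv_into_f)
  qed
  have eH: "eval_list ?P \<psi> w \<in> H" for w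
    by (induction w) (auto simp del: one_product_group mult_product_group intro!: \<psi>)
  have lift: "h (eval_list ?P \<psi> w) = eval_list N \<phi> w" for w
    by (induction w)
      (simp_all add: h1 hmult eH \<psi> del: one_product_group mult_product_group)
  have "eval_list ?P \<psi> (fst e) = eval_list ?P \<psi> (snd e)"
  proof
    fix i
    show "eval_list ?P \<psi> (fst e) i = eval_list ?P \<psi> (snd e) i"
    proof (cases "i \<in> I")
      case True
      have "range (\<lambda>l. \<psi> l i) \<subseteq> carrier M"
        using \<psi>(1) H.subset True by (fastforce simp: PiE_iff)
      with sat show ?thesis
        by (simp add: satisfies_def eval_word_eq_eval_list eval_list_product_group True)
    next
      case False
      \<comment> \<open>Outside \<open>I\<close> every member of the extensional product is
        \<open>undefined\<close>, so both sides agree there.\<close>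
      have "eval_list ?P \<psi> w \<in> carrier ?P" for w
        using eH H.subset by blast
      then have "eval_list ?P \<psi> w i = undefined" for w
        using False by (force simp: PiE_iff extensional_def)
      then show ?thesis by simp
    qed
  qed
  then show "eval_list N \<phi> (fst e) = eval_list N \<phi> (snd e)"
    by (metis lift)
qed

text \<open>Only finitely many elements of \<open>N\<close> occur in \<open>w\<close> and
  \<open>v\<close>, so an injection \<open>e\<close> can rename them to letters \<open>Z i\<close>.
  The renamed pair is an identity of \<open>M\<close>, hence of \<open>N\<close>; evaluating it in
  \<open>N\<close> at the inverse renaming returns the two products.\<close>

lemma eval_list_eq_of_identities:
  fixes M :: "('m, 'c) monoid_scheme" and N :: "('a, 'd) monoid_scheme"
  assumes M: "monoid M" and N: "monoid N"
    and sat: "\<And>e. satisfies M e \<Longrightarrow> satisfies N e"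
    and wv: "set w \<subseteq> carrier N" "set v \<subseteq> carrier N"
    and eq: "\<And>\<phi>. range \<phi> \<subseteq> carrier M \<Longrightarrow> eval_list M \<phi> w = eval_list M \<phi> v"
  shows "eval_list N id w = eval_list N id v"
proof -
  let ?A = "set w \<union> set v"
  obtain f :: "'a \<Rightarrow> nat" where f: "inj_on f ?A"
    using finite_imp_inj_to_nat_seg[of ?A] by auto
  define e where "e a = Z (f a)" for a
  have e: "inj_on e ?A"
    using f by (auto simp: e_def inj_on_def)
  have "satisfies M (map e w, map e v)"
    by (auto simp: satisfies_def eval_word_eq_eval_list eval_list_map intro!: eq)
  then have sN: "satisfies N (map e w, map e v)" by (rule sat)
  define \<chi> where "\<chi> l = (if l \<in> e ` ?A then inv_into ?A e l else \<one>\<^bsub>N\<^esub>)" for l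
  have "inv_into ?A e l \<in> carrier N" if "l \<in> e ` ?A" for l
    using inv_into_into[OF that] wv by auto
  then have "range \<chi> \<subseteq> carrier N"
    using monoid.one_closed[OF N] by (auto simp: \<chi>_def)
  with sN have "eval_list N (\<lambda>a. \<chi> (e a)) w = eval_list N (\<lambda>a. \<chi> (e a)) v"
    by (simp add: satisfies_def eval_word_eq_eval_list eval_list_map)
  moreover have "\<chi> (e a) = id a" if "a \<in> ?A" for a
    using that e by (simp add: \<chi>_def)
  ultimately show ?thesis
    by (metis (no_types, lifting) UnCI eval_list_cong)
qed

text \<open>The functions \<open>g w\<close>, which evaluate a word \<open>w\<close> over the
  elements of \<open>N\<close> at all assignments into \<open>M\<close>, form a relatively free
  monoid \<open>H\<close> inside a power of \<open>M\<close>. Sending \<open>g w\<close> to the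
  product of \<open>w\<close> in \<open>N\<close> maps it homomorphically onto
  \<open>N\<close>.\<close>

lemma var_monoidI:
  fixes M :: "'m monoid" and N :: "'a monoid"
  assumes M: "monoid M" and N: "monoid N"
    and sat: "\<And>e. satisfies M e \<Longrightarrow> satisfies N e"
  shows "N \<in> var_monoid M"
proof -
  interpret M: monoid M by fact
  interpret N: monoid N by fact
  \<comment> \<open>The assignments are the coordinates; their type is exactly the index type that
    \<open>var_monoid\<close> allows.\<close>
  define I where "I = {\<phi> :: 'a \<Rightarrow> 'm. range \<phi> \<subseteq> carrier M}"
  let ?P = "product_group I (\<lambda>_. M)"
  define W where "W = {w. set w \<subseteq> carrier N}"
  define g where "g w = (\<lambda>\<phi>\<in>I. eval_list M \<phi> w)" for w
  define H where "H = g ` W"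
  define h where "h f = eval_list N id (SOME w. w \<in> W \<and> g w = f)" for f
  \<comment> \<open>The word chosen in \<open>h\<close> is immaterial: words with the same
    \<open>g\<close> agree at all assignments into \<open>M\<close>, which amounts to an identity of
    \<open>M\<close>.\<close>
  have well_def: "eval_list N id w = eval_list N id v" if "w \<in> W" "v \<in> W" "g w = g v" for w v
  proof (rule eval_list_eq_of_identities[OF M N sat])
    show "eval_list M \<phi> w = eval_list M \<phi> v" if "range \<phi> \<subseteq> carrier M" for \<phi>
      using fun_cong[OF \<open>g w = g v\<close>, of \<phi>] that by (simp add: g_def I_def)
  qed (use that in \<open>auto simp: W_def\<close>)
  have h_g: "h (g w) = eval_list N id w" if "w \<in> W" for w
  proof -
    have "\<exists>v. v \<in> W \<and> g v = g w" using that by blast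
    from someI_ex[OF this] show ?thesis
      unfolding h_def using that well_def by blast
  qed
  have g_append: "g (u @ v) = g u \<otimes>\<^bsub>?P\<^esub> g v" for u v
    by (auto simp: g_def I_def fun_eq_iff image_subset_iff intro!: M.eval_list_append)
  have g_Nil: "g [] = \<one>\<^bsub>?P\<^esub>"
    by (auto simp: g_def)
  have W_append: "u @ v \<in> W" if "u \<in> W" "v \<in> W" for u v
    using that by (auto simp: W_def)
  have "submonoid H ?P"
  proof
    show "H \<subseteq> carrier ?P"
      by (auto simp: H_def g_def I_def image_subset_iff intro!: M.eval_list_closed)
    show "f \<otimes>\<^bsub>?P\<^esub> f' \<in> H" if "f \<in> H" "f' \<in> H" for f f'
      using that W_append unfolding H_def by (auto simp del: mult_product_group simp flip: g_append)
    show "\<one>\<^bsub>?P\<^esub> \<in> H"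
      unfolding H_def g_Nil[symmetric] by (auto simp: W_def)
  qed
  moreover have "h \<in> epi (?P\<lparr>carrier := H\<rparr>) N"
  proof -
    have "h ` H = carrier N"
    proof
      show "h ` H \<subseteq> carrier N"
        by (auto simp: H_def h_g W_def intro!: N.eval_list_closed)
      show "carrier N \<subseteq> h ` H"
      proof
        fix n assume n: "n \<in> carrier N"
        then have "[n] \<in> W" "eval_list N id [n] = n" by (auto simp: W_def)
        then show "n \<in> h ` H" unfolding H_def by (metis h_g image_eqI)
      qed
    qed
    moreover have "h (f \<otimes>\<^bsub>?P\<^esub> f') = h f \<otimes>\<^bsub>N\<^esub> h f'" if "f \<in> H" "f' \<in> H" for f f'
    proof -
      obtain u v where uv: "f = g u" "f' = g v" "u \<in> W" "v \<in> W"
        using \<open>f \<in> H\<close> \<open>f' \<in> H\<close> unfolding H_def by blast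
      have "eval_list N id (u @ v) = eval_list N id u \<otimes>\<^bsub>N\<^esub> eval_list N id v"
        using uv by (intro N.eval_list_append) (auto simp: W_def)
      then show ?thesis
        unfolding uv(1,2) g_append[symmetric] using uv(3,4) by (simp add: h_g W_append)
    qed
    ultimately show ?thesis
      unfolding epi_def hom_def by auto
  qed
  moreover have "h \<one>\<^bsub>?P\<^esub> = \<one>\<^bsub>N\<^esub>"
    unfolding g_Nil[symmetric] by (subst h_g) (auto simp: W_def)
  ultimately have "image_of_submonoid_of_power I M N"
    unfolding image_of_submonoid_of_power_def by blast
  with N show ?thesis
    unfolding var_monoid_def by blast
qed

section \<open>Equational logic\<close>

definition substitute :: "(letter \<Rightarrow> word) \<Rightarrow> word \<Rightarrow> word" where
  "substitute f w = concat (map f w)"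

lemma substitute_simps [simp]:
  "substitute f [] = []"
  "substitute f (a # w) = f a @ substitute f w"
  "substitute f (u @ v) = substitute f u @ substitute f v"
  by (simp_all add: substitute_def)

lemma substitute_substitute:
  "substitute f (substitute g w) = substitute (\<lambda>l. substitute f (g l)) w"
  by (induction w) auto

lemma substitute_concat_map:
  "substitute f (concat (map g xs)) = concat (map (\<lambda>i. substitute f (g i)) xs)"
  by (induction xs) auto

text \<open>Contexts and substitutions are built into the axiom steps, so a derivation is a zigzag
  of elementary rewritings.\<close>

inductive derivable :: "(word \<times> word) set \<Rightarrow> word \<Rightarrow> word \<Rightarrow> bool" for \<Sigma> where
  ax: "(u, v) \<in> \<Sigma> \<Longrightarrow> derivable \<Sigma> (p @ substitute f u @ q) (p @ substitute f v @ q)"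
| refl: "derivable \<Sigma> u u"
| sym: "derivable \<Sigma> u v \<Longrightarrow> derivable \<Sigma> v u"
| trans [trans]: "derivable \<Sigma> u v \<Longrightarrow> derivable \<Sigma> v w \<Longrightarrow> derivable \<Sigma> u w"

lemma derivable_context:
  "derivable \<Sigma> u v \<Longrightarrow> derivable \<Sigma> (p @ u @ q) (p @ v @ q)"
proof (induction rule: derivable.induct)
  case (ax u v p' f q')
  then show ?case
    using derivable.ax[OF ax, of "p @ p'" f "q' @ q"] by simp
qed (auto intro: derivable.intros)

lemma satisfies_derivable:
  assumes N: "monoid N" and \<Sigma>: "\<forall>e\<in>\<Sigma>. satisfies N e" and "derivable \<Sigma> u v"
  shows "satisfies N (u, v)"
  using \<open>derivable \<Sigma> u v\<close>
proof (induction rule: derivable.induct)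
  case (ax u v p f q)
  interpret N: monoid N by fact
  show ?case
    unfolding satisfies_def eval_word_eq_eval_list fst_conv snd_conv
  proof (intro allI impI)
    fix \<phi> :: "letter \<Rightarrow> 'a"
    assume \<phi>: "range \<phi> \<subseteq> carrier N"
    then have img: "\<phi> ` B \<subseteq> carrier N" for B by auto
    \<comment> \<open>A substitution followed by an assignment is again an assignment, at which the
      axiom can be applied.\<close>
    have subst: "eval_list N \<phi> (substitute f w) = eval_list N (\<lambda>l. eval_list N \<phi> (f l)) w" for w
      by (induction w) (simp_all add: N.eval_list_append img)
    have "range (\<lambda>l. eval_list N \<phi> (f l)) \<subseteq> carrier N"
      using img by auto
    with \<Sigma> ax have "eval_list N \<phi> (substitute f u) = eval_list N \<phi> (substitute f v)"
      unfolding subst by (auto simp: satisfies_def eval_word_eq_eval_list)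
    then show "eval_list N \<phi> (p @ substitute f u @ q) = eval_list N \<phi> (p @ substitute f v @ q)"
      by (simp add: N.eval_list_append img del: set_append)
  qed
qed (auto simp: satisfies_def)

section \<open>Identities of Rees quotients of the free monoid\<close>

text \<open>The two kinds of congruence classes: single subwords of \<open>w\<close>, and the zero
  of the quotient, which collects all other words.\<close>

definition rees_class :: "word \<Rightarrow> word \<Rightarrow> word set" where
  "rees_class w a = (if sublist a w then {a} else {u. \<not> sublist u w})"

lemma rees_congruence_class:
  "rees_congruence free_monoid (carrier free_monoid - {u. sublist u w}) `` {a} = rees_class w a"
  by (auto simp: rees_congruence_def rees_class_def free_monoid_def)

lemma rees_class_eq_iff:
  "rees_class w a = rees_class w b \<longleftrightarrow> a = b \<or> \<not> sublist a w \<and> \<not> sublist b w"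
  by (auto simp: rees_class_def)

lemma rees_class_append_cong:
  assumes "a' \<in> rees_class w a" "b' \<in> rees_class w b"
  shows "rees_class w (a' @ b') = rees_class w (a @ b)"
proof -
  have factors: "sublist c w" "sublist d w" if "sublist (c @ d) w" for c d
    using that by (meson sublist_append_leftI sublist_append_rightI sublist_order.order_trans)+
  show ?thesis
  proof (cases "a' = a \<and> b' = b")
    case False
    then have "\<not> sublist a w \<and> \<not> sublist a' w \<or> \<not> sublist b w \<and> \<not> sublist b' w"
      using assms by (simp add: rees_class_def split: if_splits)
    then have "\<not> sublist (a' @ b') w \<and> \<not> sublist (a @ b) w"
      using factors by metis
    then show ?thesis by (simp add: rees_class_eq_iff)
  qed simp
qed

lemma S_monoid_simps:
  "carrier (S_monoid w) = range (rees_class w)"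
  "\<one>\<^bsub>S_monoid w\<^esub> = rees_class w []"
  "rees_class w a \<otimes>\<^bsub>S_monoid w\<^esub> rees_class w b = rees_class w (a @ b)"
proof -
  show "carrier (S_monoid w) = range (rees_class w)"
    by (auto simp: S_monoid_def rees_quotient_def quotient_def rees_congruence_class)
      (auto simp: free_monoid_def)
  show "\<one>\<^bsub>S_monoid w\<^esub> = rees_class w []"
    by (simp add: S_monoid_def rees_quotient_def rees_congruence_class)
      (simp add: free_monoid_def)
  have "x \<in> rees_class w x" for x
    by (simp add: rees_class_def)
  then have "(\<Union>x\<in>rees_class w a. \<Union>y\<in>rees_class w b. rees_class w (x @ y)) = rees_class w (a @ b)"
    using rees_class_append_cong by blast
  then show "rees_class w a \<otimes>\<^bsub>S_monoid w\<^esub> rees_class w b = rees_class w (a @ b)"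
    by (simp add: S_monoid_def rees_quotient_def rees_congruence_class)
      (simp add: free_monoid_def)
qed

lemma monoid_S_monoid: "monoid (S_monoid w)"
  by unfold_locales (auto simp: S_monoid_simps)

text \<open>Assignments into \<open>S_monoid w\<close> are the substitutions followed by the
  quotient map, and two words have the same class exactly when they are equal or both zero.\<close>

lemma satisfies_S_monoid_iff:
  "satisfies (S_monoid w) (u, v) \<longleftrightarrow>
     (\<forall>f. sublist (substitute f u) w \<or> sublist (substitute f v) w \<longrightarrow>
          substitute f u = substitute f v)"
proof -
  have ev: "eval_word (S_monoid w) (\<lambda>l. rees_class w (f l)) x = rees_class w (substitute f x)" for f x
    unfolding eval_word_eq_eval_list by (induction x) (auto simp: S_monoid_simps)
  have "range \<phi> \<subseteq> carrier (S_monoid w) \<longleftrightarrow> (\<exists>f. \<phi> = (\<lambda>l. rees_class w (f l)))" for \<phi> :: "letter \<Rightarrow> word set"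
    unfolding S_monoid_simps by (auto simp: image_subset_iff image_iff fun_eq_iff intro: choice)
  then have "satisfies (S_monoid w) (u, v) \<longleftrightarrow>
      (\<forall>f. rees_class w (substitute f u) = rees_class w (substitute f v))"
    unfolding satisfies_def fst_conv snd_conv by (metis ev)
  then show ?thesis
    unfolding rees_class_eq_iff by auto
qed

section \<open>Soundness of the identities\<close>

abbreviation generating_word :: word where
  "generating_word \<equiv> [X, Z 0, X, Y, T 0, Y]"

lemma generating_word_repeated_letter:
  assumes "p @ l # q @ l # r = generating_word"
  shows "l = X \<and> p = [] \<and> q = [Z 0] \<and> r = [Y, T 0, Y] \<or>
         l = Y \<and> p = [X, Z 0, X] \<and> q = [T 0] \<and> r = []"
proof -
  consider "p = []" "l # q @ l # r = [X, Z 0, X, Y, T 0, Y]"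
    | "p = [X]" "l # q @ l # r = [Z 0, X, Y, T 0, Y]"
    | "p = [X, Z 0]" "l # q @ l # r = [X, Y, T 0, Y]"
    | "p = [X, Z 0, X]" "l # q @ l # r = [Y, T 0, Y]"
    | "p = [X, Z 0, X, Y]" "l # q @ l # r = [T 0, Y]"
    | "p = [X, Z 0, X, Y, T 0]" "l # q @ l # r = [Y]"
    using assms by (simp only: append_eq_Cons_conv) blast
  then show ?thesis
    by cases (auto simp: append_eq_Cons_conv)
qed

text \<open>The first letter of \<open>a\<close> is repeated in the generating word, hence is
  \<open>X\<close> or \<open>Y\<close>. A longer \<open>a\<close> is impossible because the two
  occurrences of that letter are not followed by the same letter.\<close>

lemma generating_word_repeated_factor:
  assumes "sublist (p @ a @ q @ a @ r) generating_word" "a \<noteq> []"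
  shows "a = [X] \<and> q = [Z 0] \<and> p = [] \<and> set r \<subseteq> {Y, T 0} \<or>
         a = [Y] \<and> q = [T 0] \<and> r = [] \<and> set p \<subseteq> {X, Z 0}"
proof -
  from assms(2) obtain l a' where a: "a = l # a'" by (cases a) auto
  obtain p' r' where "generating_word = p' @ (p @ a @ q @ a @ r) @ r'"
    using assms(1) unfolding sublist_def by blast
  then have "(p' @ p) @ l # (a' @ q) @ l # (a' @ r @ r') = generating_word"
    by (simp add: a)
  from generating_word_repeated_letter[OF this] show ?thesis
    unfolding a by (auto simp: append_eq_Cons_conv)
qed

lemma generating_word_repeated_factor':
  assumes "sublist (p @ a @ q @ a @ r) generating_word" "a \<noteq> []"
  shows "q = [Z 0] \<or> q = [T 0]" "a = [X] \<or> a = [Y]"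
  using generating_word_repeated_factor[OF assms] by auto

text \<open>A nonzero value of either side forces \<open>X\<close> to be erased, or \<open>X\<close>
  or \<open>Y\<close> in \<open>sigma1\<close> and \<open>sigma2\<close>; then both sides coincide.
  Otherwise a repeated factor would have a gap that is empty, or not one of the single letters
  \<open>Z 0\<close> and \<open>T 0\<close>.\<close>

lemma satisfies_L_identities:
  assumes "e \<in> L_identities"
  shows "satisfies (S_monoid generating_word) e"
proof -
  note rep = generating_word_repeated_factor'
  have no_square: "f = []" if "sublist (p @ f @ f @ q) generating_word" for p q f :: word
    using rep(1)[of p f "[]" q] that by auto
  consider "e = ([X, X, Y], [Y, X, X])" | "e = ([X, Y, X, Z 0, X], [X, X, Y, Z 0])"
    | "e = sigma1" | "e = sigma2"
    | n \<pi> \<tau> where "e = (w_word n \<pi> \<tau>, w_word' n \<pi> \<tau>)" "\<pi> permutes {1..n}" "\<tau> permutes {1..n}"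
    using assms unfolding L_identities_def by blast
  then show ?thesis
  proof cases
    case 1
    show ?thesis
      unfolding 1 satisfies_S_monoid_iff
    proof (intro allI impI)
      fix f
      assume "sublist (substitute f [X, X, Y]) generating_word \<or>
        sublist (substitute f [Y, X, X]) generating_word"
      then have "f X = []"
        using no_square[of "[]" "f X" "f Y"] no_square[of "f Y" "f X" "[]"] by auto
      then show "substitute f [X, X, Y] = substitute f [Y, X, X]" by simp
    qed
  next
    case 2
    show ?thesis
      unfolding 2 satisfies_S_monoid_iff
    proof (intro allI impI)
      fix f
      assume "sublist (substitute f [X, Y, X, Z 0, X]) generating_word \<or>
        sublist (substitute f [X, X, Y, Z 0]) generating_word"
      then have "f X = []"
        using no_square[of "[]" "f X" "f Y @ f (Z 0)"]
          rep[of "[]" "f X" "f Y @ f X @ f (Z 0)" "[]"]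
        by (cases "f X = []") (auto simp: append_eq_Cons_conv)
      then show "substitute f [X, Y, X, Z 0, X] = substitute f [X, X, Y, Z 0]" by simp
    qed
  next
    case 3
    show ?thesis
      unfolding 3 sigma1_def satisfies_S_monoid_iff
    proof (intro allI impI)
      fix f
      assume "sublist (substitute f [X, Y, Z 0, X, T 0, Y]) generating_word \<or>
        sublist (substitute f [Y, X, Z 0, X, T 0, Y]) generating_word"
      then have "f X = [] \<or> f Y = []"
        using rep[of "[]" "f X" "f Y @ f (Z 0)" "f (T 0) @ f Y"]
          rep[of "f X" "f Y" "f (Z 0) @ f X @ f (T 0)" "[]"]
          rep[of "[]" "f Y" "f X @ f (Z 0) @ f X @ f (T 0)" "[]"]
        by (auto simp: append_eq_Cons_conv)
      then show "substitute f [X, Y, Z 0, X, T 0, Y] = substitute f [Y, X, Z 0, X, T 0, Y]"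
        by auto
    qed
  next
    case 4
    show ?thesis
      unfolding 4 sigma2_def satisfies_S_monoid_iff
    proof (intro allI impI)
      fix f
      assume "sublist (substitute f [X, T 0, Y, Z 0, X, Y]) generating_word \<or>
        sublist (substitute f [X, T 0, Y, Z 0, Y, X]) generating_word"
      then have "f X = [] \<or> f Y = []"
        using rep[of "[]" "f X" "f (T 0) @ f Y @ f (Z 0)" "f Y"]
          rep[of "f X @ f (T 0)" "f Y" "f (Z 0) @ f X" "[]"]
          rep[of "[]" "f X" "f (T 0) @ f Y @ f (Z 0) @ f Y" "[]"]
        by (auto simp: append_eq_Cons_conv)
      then show "substitute f [X, T 0, Y, Z 0, X, Y] = substitute f [X, T 0, Y, Z 0, Y, X]"
        by auto
    qed
  next
    case 5
    show ?thesis
      unfolding 5(1) satisfies_S_monoid_iff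
    proof (intro allI impI)
      fix f
      let ?p = "substitute f (concat (map (\<lambda>i. [Z i, T i]) [1..<n + 1]))"
      let ?q = "substitute f (concat (map (\<lambda>i. [Z (\<pi> i), Z (n + \<tau> i)]) [1..<n + 1]))"
      let ?r = "substitute f (concat (map (\<lambda>i. [T i, Z i]) [n + 1..<2 * n + 1]))"
      assume "sublist (substitute f (w_word n \<pi> \<tau>)) generating_word \<or>
        sublist (substitute f (w_word' n \<pi> \<tau>)) generating_word"
      then have "sublist (?p @ f X @ ?q @ f X @ ?r) generating_word \<or>
          sublist (?p @ f X @ f X @ ?q @ ?r) generating_word"
        by (simp add: w_word_def w_word'_def)
      moreover have "f X = []" if sub: "sublist (?p @ f X @ ?q @ f X @ ?r) generating_word"
      proof (rule ccontr)
        assume "f X \<noteq> []"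
        note cases = generating_word_repeated_factor[OF sub this]
        \<comment> \<open>Each variable of the middle block also occurs in an outer block. But the
          gap between the two copies of \<open>f X\<close> is a simple letter of the generating
          word, which cannot occur again outside.\<close>
        have sub_pr: "set ?q \<subseteq> set ?p \<union> set ?r"
        proof
          fix l assume "l \<in> set ?q"
          then obtain i where i: "i \<in> {1..n}" and l: "l \<in> set (f (Z (\<pi> i))) \<or> l \<in> set (f (Z (n + \<tau> i)))"
            unfolding substitute_concat_map by (auto simp: less_Suc_eq_le simp del: upt_Suc)
          have "\<pi> i \<in> {1..n}" "\<tau> i \<in> {1..n}"
            using i 5 permutes_in_image by metis+
          then have "\<pi> i \<in> set [1..<n + 1]" "n + \<tau> i \<in> set [n + 1..<2 * n + 1]"
            by (auto simp: less_Suc_eq_le simp del: upt_Suc)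
          with l show "l \<in> set ?p \<union> set ?r"
            unfolding substitute_concat_map by (fastforce simp del: upt_Suc)
        qed
        from cases show False
          using sub_pr by auto
      qed
      ultimately have "f X = []"
        using no_square by blast
      then show "substitute f (w_word n \<pi> \<tau>) = substitute f (w_word' n \<pi> \<tau>)"
        by (simp add: w_word_def w_word'_def)
    qed
  qed
qed

section \<open>Collecting squares\<close>

abbreviation L_equiv :: "word \<Rightarrow> word \<Rightarrow> bool" (infix "\<sim>\<^sub>L" 50) where
  "u \<sim>\<^sub>L v \<equiv> derivable L_identities u v"

section \<open>The four short identities in context, with arbitrary, possibly empty, words for the
  letters\<close>

lemma L_square_central: "p @ a @ a @ b @ q \<sim>\<^sub>L p @ b @ a @ a @ q"
  using derivable.ax[of "[X, X, Y]" "[Y, X, X]" L_identities p "(\<lambda>_. [])(X := a, Y := b)" q]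
  by (simp add: L_identities_def)

lemma L_collect_three: "p @ a @ b @ a @ c @ a @ q \<sim>\<^sub>L p @ a @ a @ b @ c @ q"
  using derivable.ax[of "[X, Y, X, Z 0, X]" "[X, X, Y, Z 0]" L_identities p
      "(\<lambda>_. [])(X := a, Y := b, Z 0 := c)" q]
  by (simp add: L_identities_def)

lemma L_swap_first: "p @ a @ b @ c @ a @ d @ b @ q \<sim>\<^sub>L p @ b @ a @ c @ a @ d @ b @ q"
  using derivable.ax[of "fst sigma1" "snd sigma1" L_identities p
      "(\<lambda>_. [])(X := a, Y := b, Z 0 := c, T 0 := d)" q]
  by (simp add: L_identities_def sigma1_def)

lemma L_swap_second: "p @ a @ d @ b @ c @ a @ b @ q \<sim>\<^sub>L p @ a @ d @ b @ c @ b @ a @ q"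
  using derivable.ax[of "fst sigma2" "snd sigma2" L_identities p
      "(\<lambda>_. [])(X := a, Y := b, Z 0 := c, T 0 := d)" q]
  by (simp add: L_identities_def sigma2_def)

text \<open>Taking \<open>b\<close> empty in \<open>L_collect_three\<close> removes one further
  occurrence of \<open>x\<close> at a time.\<close>

lemma L_square_absorbs: "[x, x] @ w \<sim>\<^sub>L [x, x] @ removeAll x w"
proof (induction "length w" arbitrary: w rule: less_induct)
  case less
  show ?case
  proof (cases "x \<in> set w")
    case True
    then obtain p q where w: "w = p @ x # q"
      by (meson split_list)
    have "[x, x] @ w \<sim>\<^sub>L [x, x] @ p @ q"
      using L_collect_three[of "[]" "[x]" "[]" p q] by (simp add: w)
    also have "[x, x] @ p @ q \<sim>\<^sub>L [x, x] @ removeAll x (p @ q)"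
      by (rule less) (simp add: w)
    finally show ?thesis by (simp add: w)
  qed (simp add: derivable.refl)
qed

text \<open>The cut exhibits \<open>p\<close> as a value of the block of letters \<open>Z i\<close>,
  \<open>T i\<close> that opens \<open>w_word\<close>, up to a prefix: \<open>e j\<close> is the
  value of some \<open>Z i\<close> and \<open>t j\<close> that of the \<open>T i\<close> after it.
  The order \<open>js\<close> of the slots is dictated by \<open>p\<close>, except that empty slots
  fit anywhere.\<close>

lemma slots_left:
  fixes e :: "'i \<Rightarrow> 'b list"
  assumes "finite J" "\<forall>j\<in>J. e j = [] \<or> (\<exists>b\<in>set p. e j = [b])"
    and "\<forall>i\<in>J. \<forall>j\<in>J. e i = e j \<longrightarrow> i = j \<or> e i = []"
  shows "\<exists>p0 t js. distinct js \<and> set js = J \<and> p = p0 @ concat (map (\<lambda>j. e j @ t j) js)"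
  using assms
proof (induction p arbitrary: J)
  case Nil
  obtain js where js: "distinct js" "set js = J"
    using finite_distinct_list[OF Nil(1)] by blast
  have "\<forall>j\<in>set js. e j = []"
    using Nil(2) js by simp
  with js show ?case
    by - (rule exI[of _ "[]"], rule exI[of _ "\<lambda>_. []"], rule exI[of _ js], simp)
next
  case (Cons a p)
  show ?case
  proof (cases "\<exists>j\<in>J. e j = [a]")
    case True
    then obtain j where j: "j \<in> J" "e j = [a]" by blast
    have "\<exists>p0 t js. distinct js \<and> set js = J - {j} \<and> p = p0 @ concat (map (\<lambda>j. e j @ t j) js)"
    proof (rule Cons.IH)
      show "\<forall>i\<in>J - {j}. e i = [] \<or> (\<exists>b\<in>set p. e i = [b])"
      proof
        fix i assume i: "i \<in> J - {j}"
        then have "e i = [] \<or> e i \<noteq> [a]"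
          using Cons.prems(3) j by force
        then show "e i = [] \<or> (\<exists>b\<in>set p. e i = [b])"
          using Cons.prems(2) i by auto
      qed
    qed (use Cons.prems(1,3) in blast)+
    then obtain p0 t js where js: "distinct js" "set js = J - {j}"
      and p: "p = p0 @ concat (map (\<lambda>j. e j @ t j) js)" by blast
    \<comment> \<open>The text \<open>p0\<close> in front of the slots found so far becomes the text
      that follows the new slot \<open>j\<close>.\<close>
    have "concat (map (\<lambda>i. e i @ (t(j := p0)) i) js) = concat (map (\<lambda>i. e i @ t i) js)"
      using js by (intro arg_cong[where f = concat] map_cong) auto
    then have "a # p = [] @ concat (map (\<lambda>i. e i @ (t(j := p0)) i) (j # js))"
      using j p by (simp del: fun_upd_apply add: fun_upd_same)
    moreover have "distinct (j # js)" "set (j # js) = J"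
      using js j by auto
    ultimately show ?thesis
      by - (rule exI[of _ "[]"], rule exI[of _ "t(j := p0)"], rule exI[of _ "j # js"], simp)
  next
    case False
    have "\<exists>p0 t js. distinct js \<and> set js = J \<and> p = p0 @ concat (map (\<lambda>j. e j @ t j) js)"
    proof (rule Cons.IH)
      show "\<forall>j\<in>J. e j = [] \<or> (\<exists>b\<in>set p. e j = [b])"
        using Cons.prems(2) False by auto
    qed (use Cons.prems(1,3) in blast)+
    then obtain p0 t js where "distinct js" "set js = J"
      and "p = p0 @ concat (map (\<lambda>j. e j @ t j) js)" by blast
    then show ?thesis
      by - (rule exI[of _ "a # p0"], rule exI[of _ t], rule exI[of _ js], simp)
  qed
qed

text \<open>The mirror image of \<open>slots_left\<close>, for the closing block of
  \<open>w_word\<close>; slots have length at most one and are therefore unchanged by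
  reversal.\<close>

lemma slots_right:
  fixes e :: "'i \<Rightarrow> 'b list"
  assumes "finite J" and e: "\<forall>j\<in>J. e j = [] \<or> (\<exists>b\<in>set r. e j = [b])"
    and "\<forall>i\<in>J. \<forall>j\<in>J. e i = e j \<longrightarrow> i = j \<or> e i = []"
  shows "\<exists>r0 t js. distinct js \<and> set js = J \<and> r = concat (map (\<lambda>j. t j @ e j) js) @ r0"
proof -
  obtain p0 t js where js: "distinct js" "set js = J"
    and p: "rev r = p0 @ concat (map (\<lambda>j. e j @ t j) js)"
    using slots_left[of J e "rev r"] assms by auto
  have "rev (e j) = e j" if "j \<in> J" for j
    using e that by auto
  then have "map (\<lambda>j. rev (t j) @ e j) (rev js) = map rev (rev (map (\<lambda>j. e j @ t j) js))"
    using js by (simp add: rev_map)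
  then have "r = concat (map (\<lambda>j. rev (t j) @ e j) (rev js)) @ rev p0"
    using p by (metis rev_append rev_concat rev_rev_ident)
  then show ?thesis
    using js by - (rule exI[of _ "rev p0"], rule exI[of _ "\<lambda>j. rev (t j)"], rule exI[of _ "rev js"], simp)
qed

lemma distinct_list_permutes:
  assumes "distinct js" "set js = {1..n}"
  shows "\<exists>\<sigma>. \<sigma> permutes {1..n} \<and> js = map \<sigma> [1..<n + 1]"
proof -
  have len: "length js = n"
    using distinct_card[OF assms(1)] assms(2) by simp
  define \<sigma> where "\<sigma> i = (if i \<in> {1..n} then js ! (i - 1) else i)" for i
  have js: "js = map \<sigma> [1..<n + 1]"
    by (rule nth_equalityI) (auto simp: len \<sigma>_def simp del: upt_Suc)
  have "{1..n} = set [1..<n + 1]" by auto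
  then have "bij_betw \<sigma> {1..n} {1..n}"
    using assms unfolding bij_betw_def js by (metis distinct_map list.set_map)
  then have "\<sigma> permutes {1..n}"
    by (rule bij_imp_permutes) (auto simp: \<sigma>_def)
  with js show ?thesis by blast
qed

lemma map_upt_shift: "map f [n + 1..<2 * n + 1] = map (\<lambda>i. f (n + i)) [1..<n + 1]"
  by (rule nth_equalityI) (auto simp: add.assoc simp del: upt_Suc)

text \<open>
  The \<open>i\<close>-th letter of \<open>q\<close> is produced by one of \<open>z\<^bsub>\<pi>(i)\<^esub>\<close> and \<open>z\<^bsub>n+\<tau>(i)\<^esub>\<close>, according to the side on
  which it occurs again; the other variable of the pair is erased.
\<close>

lemma L_collect_two_distinct:
  assumes "distinct q" "set q \<subseteq> set p \<union> set r"
  shows "p @ [x] @ q @ [x] @ r \<sim>\<^sub>L p @ [x, x] @ q @ r"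
proof -
  define n where "n = length q"
  define e where "e j = (if q ! (j - 1) \<in> set p then [q ! (j - 1)] else [])" for j
  define e' where "e' j = (if q ! (j - 1) \<in> set p then [] else [q ! (j - 1)])" for j
  have q_mem: "q ! (j - 1) \<in> set p \<or> q ! (j - 1) \<in> set r" if "j \<in> {1..n}" for j
  proof -
    have "q ! (j - 1) \<in> set q"
      using that by (intro nth_mem) (auto simp: n_def)
    with assms(2) show ?thesis by blast
  qed
  have q_inj: "i = j" if "i \<in> {1..n}" "j \<in> {1..n}" "q ! (i - 1) = q ! (j - 1)" for i j
    using that assms(1) by (auto simp: n_def nth_eq_iff_index_eq)
  have "\<exists>p0 t js. distinct js \<and> set js = {1..n} \<and> p = p0 @ concat (map (\<lambda>j. e j @ t j) js)"
    by (rule slots_left) (use q_inj in \<open>auto simp: e_def\<close>)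
  then obtain p0 t js where js: "distinct js" "set js = {1..n}" and eq: "p = p0 @ concat (map (\<lambda>j. e j @ t j) js)"
    by blast
  obtain \<sigma> where \<sigma>: "\<sigma> permutes {1..n}" and "js = map \<sigma> [1..<n + 1]"
    using distinct_list_permutes[OF js] by blast
  with eq have p: "p = p0 @ concat (map (\<lambda>i. e (\<sigma> i) @ t (\<sigma> i)) [1..<n + 1])"
    by (simp add: comp_def del: upt_Suc)
  have "\<exists>r0 t js. distinct js \<and> set js = {1..n} \<and> r = concat (map (\<lambda>j. t j @ e' j) js) @ r0"
  proof (rule slots_right)
    show "\<forall>j\<in>{1..n}. e' j = [] \<or> (\<exists>b\<in>set r. e' j = [b])"
    proof
      fix j assume "j \<in> {1..n}"
      from q_mem[OF this] show "e' j = [] \<or> (\<exists>b\<in>set r. e' j = [b])"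
        by (auto simp: e'_def)
    qed
  qed (use q_inj in \<open>auto simp: e'_def\<close>)
  then obtain r0 t' js where js: "distinct js" "set js = {1..n}" and eq: "r = concat (map (\<lambda>j. t' j @ e' j) js) @ r0"
    by blast
  obtain \<sigma>' where \<sigma>': "\<sigma>' permutes {1..n}" and "js = map \<sigma>' [1..<n + 1]"
    using distinct_list_permutes[OF js] by blast
  with eq have r: "r = concat (map (\<lambda>i. t' (\<sigma>' i) @ e' (\<sigma>' i)) [1..<n + 1]) @ r0"
    by (simp add: comp_def del: upt_Suc)
  \<comment> \<open>In the opening block \<open>Z k\<close> has the value
    \<open>e (\<sigma> k)\<close>. The middle block needs the value \<open>e i\<close> at its
    \<open>i\<close>-th place, so \<open>\<pi>\<close> has to invert \<open>\<sigma>\<close>;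
    likewise for \<open>\<tau>\<close> and \<open>\<sigma>'\<close>.\<close>
  define \<pi> where "\<pi> = inv_into UNIV \<sigma>"
  define \<tau> where "\<tau> = inv_into UNIV \<sigma>'"
  have \<pi>: "\<pi> permutes {1..n}" and \<tau>: "\<tau> permutes {1..n}"
    using \<sigma> \<sigma>' by (simp_all add: \<pi>_def \<tau>_def permutes_inv)
  have inv: "\<sigma> (\<pi> i) = i" "\<sigma>' (\<tau> i) = i" for i
    using \<sigma> \<sigma>' by (simp_all add: \<pi>_def \<tau>_def permutes_inverses)
  have range: "\<pi> i \<le> n" "\<tau> i \<ge> 1" if "i \<in> {1..n}" for i
    using permutes_in_image[OF \<pi>, of i] permutes_in_image[OF \<tau>, of i] that by auto
  define f where "f l = (case l of X \<Rightarrow> [x] | Y \<Rightarrow> []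
      | Z i \<Rightarrow> if i \<le> n then e (\<sigma> i) else e' (\<sigma>' (i - n))
      | T i \<Rightarrow> if i \<le> n then t (\<sigma> i) else t' (\<sigma>' (i - n)))" for l
  have left: "substitute f (concat (map (\<lambda>i. [Z i, T i]) [1..<n + 1])) =
      concat (map (\<lambda>i. e (\<sigma> i) @ t (\<sigma> i)) [1..<n + 1])"
    unfolding substitute_concat_map
    by (intro arg_cong[where f = concat] map_cong) (auto simp: f_def)
  have right: "substitute f (concat (map (\<lambda>i. [T i, Z i]) [n + 1..<2 * n + 1])) =
      concat (map (\<lambda>i. t' (\<sigma>' i) @ e' (\<sigma>' i)) [1..<n + 1])"
    unfolding substitute_concat_map map_upt_shift
    by (intro arg_cong[where f = concat] map_cong) (auto simp: f_def)
  have "map (\<lambda>i. substitute f [Z (\<pi> i), Z (n + \<tau> i)]) [1..<n + 1] = map (\<lambda>i. [q ! (i - 1)]) [1..<n + 1]"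
  proof (rule map_cong)
    fix i assume "i \<in> set [1..<n + 1]"
    then have "i \<in> {1..n}" by auto
    from range[OF this] show "substitute f [Z (\<pi> i), Z (n + \<tau> i)] = [q ! (i - 1)]"
      by (simp add: f_def inv e_def e'_def)
  qed simp
  also have "\<dots> = map (\<lambda>a. [a]) q"
    by (rule nth_equalityI) (auto simp: n_def simp del: upt_Suc)
  finally have middle: "substitute f (concat (map (\<lambda>i. [Z (\<pi> i), Z (n + \<tau> i)]) [1..<n + 1])) = q"
    unfolding substitute_concat_map by simp
  have fX: "f X = [x]" by (simp add: f_def)
  have "(w_word n \<pi> \<tau>, w_word' n \<pi> \<tau>) \<in> L_identities"
    using \<pi> \<tau> by (auto simp: L_identities_def)
  from derivable.ax[OF this, of p0 f r0] show ?thesis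
    unfolding w_word_def w_word'_def substitute_simps left right middle fX p r by simp
qed

text \<open>Induction on the length of the gap \<open>q\<close>. If \<open>q\<close> is free of
  \<open>x\<close> and has distinct letters, each of them occurs again in \<open>p\<close> or
  \<open>r\<close>, and \<open>L_collect_two_distinct\<close> applies. A letter repeated inside
  \<open>q\<close> is pulled out temporarily to shorten the gap.\<close>

lemma L_collect_two:
  assumes "\<forall>y\<in>set q. y = x \<or> 2 \<le> count_list (p @ [x] @ q @ [x] @ r) y"
  shows "p @ [x] @ q @ [x] @ r \<sim>\<^sub>L [x, x] @ p @ q @ r"
  using assms
proof (induction "length q" arbitrary: p q r x rule: less_induct)
  case less
  note IH = less.hyps
  consider "x \<in> set q" | "x \<notin> set q" "distinct q" | "x \<notin> set q" "\<not> distinct q" by blast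
  then show ?case
  proof cases
    case 1
    then obtain q1 q2 where q: "q = q1 @ x # q2" by (meson split_list)
    have "p @ [x] @ q @ [x] @ r \<sim>\<^sub>L p @ [x, x] @ q1 @ q2 @ r"
      using L_collect_three[of p "[x]" q1 q2 r] by (simp add: q)
    \<comment> \<open>Read backwards with \<open>b\<close> empty, the identity reinserts the middle
      \<open>x\<close> after the square.\<close>
    also have "\<dots> \<sim>\<^sub>L p @ [x, x] @ q @ r"
      using L_collect_three[of p "[x]" "[]" q1 "q2 @ r"] by (simp add: q derivable.sym)
    also have "\<dots> \<sim>\<^sub>L [x, x] @ p @ q @ r"
      using L_square_central[of "[]" "[x]" p "q @ r"] by (simp add: derivable.sym)
    finally show ?thesis .
  next
    case 2
    have "set q \<subseteq> set p \<union> set r"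
    proof
      fix y assume y: "y \<in> set q"
      then have "count_list q y = 1"
        using 2(2) by (induction q) (auto simp: count_list_0_iff)
      moreover have "y \<noteq> x" using y 2(1) by auto
      ultimately have "count_list p y + count_list r y \<noteq> 0"
        using less.prems y by force
      then show "y \<in> set p \<union> set r"
        by (metis UnCI add.right_neutral count_list_0_iff)
    qed
    with 2(2) have "p @ [x] @ q @ [x] @ r \<sim>\<^sub>L p @ [x, x] @ q @ r"
      by (rule L_collect_two_distinct)
    also have "\<dots> \<sim>\<^sub>L [x, x] @ p @ q @ r"
      using L_square_central[of "[]" "[x]" p "q @ r"] by (simp add: derivable.sym)
    finally show ?thesis .
  next
    case 3
    then obtain q1 q2 q3 z where q: "q = q1 @ [z] @ q2 @ [z] @ q3"
      using not_distinct_decomp by blast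
    have xq: "z \<noteq> x" "x \<notin> set q1" "x \<notin> set q2" "x \<notin> set q3"
      using 3 by (auto simp: q)
    have "p @ [x] @ q @ [x] @ r = (p @ [x] @ q1) @ [z] @ q2 @ [z] @ (q3 @ [x] @ r)"
      by (simp add: q)
    \<comment> \<open>Moving both \<open>z\<close> to the front keeps all letter counts, so the
      shorter gap of \<open>x\<close> still satisfies the assumption.\<close>
    also have "\<dots> \<sim>\<^sub>L [z, z] @ (p @ [x] @ q1) @ q2 @ (q3 @ [x] @ r)"
      by (rule IH) (use less.prems xq in \<open>auto simp: q\<close>)
    also have "\<dots> = ([z, z] @ p) @ [x] @ (q1 @ q2 @ q3) @ [x] @ r" by simp
    also have "\<dots> \<sim>\<^sub>L [x, x] @ ([z, z] @ p) @ (q1 @ q2 @ q3) @ r"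
      by (rule IH) (use less.prems xq in \<open>auto simp: q\<close>)
    also have "\<dots> \<sim>\<^sub>L [z, z] @ ([x, x] @ p @ q1) @ q2 @ (q3 @ r)"
      using L_square_central[of "[]" "[x]" "[z, z]" "p @ q1 @ q2 @ q3 @ r"] by simp
    \<comment> \<open>Once \<open>x\<close> is collected, the collection of \<open>z\<close> is
      undone to restore \<open>q\<close>.\<close>
    also have "\<dots> \<sim>\<^sub>L ([x, x] @ p @ q1) @ [z] @ q2 @ [z] @ (q3 @ r)"
      by (rule derivable.sym, rule IH) (use less.prems xq in \<open>auto simp: q\<close>)
    also have "\<dots> = [x, x] @ p @ q @ r" by (simp add: q)
    finally show ?thesis .
  qed
qed

section \<open>Identities of the generating monoid\<close>

definition restrict_word :: "letter set \<Rightarrow> word \<Rightarrow> word" where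
  "restrict_word A w = filter (\<lambda>l. l \<in> A) w"

lemma restrict_word_simps [simp]:
  "restrict_word A [] = []"
  "restrict_word A (l # w) = (if l \<in> A then l # restrict_word A w else restrict_word A w)"
  "restrict_word A (u @ v) = restrict_word A u @ restrict_word A v"
  "set (restrict_word A w) = set w \<inter> A"
  by (auto simp: restrict_word_def)

lemma restrict_word_cong:
  "(\<And>l. l \<in> set w \<Longrightarrow> l \<in> A \<longleftrightarrow> l \<in> B) \<Longrightarrow> restrict_word A w = restrict_word B w"
  by (auto simp: restrict_word_def intro: filter_cong)

lemma restrict_word_eq_Nil_iff: "restrict_word A w = [] \<longleftrightarrow> set w \<inter> A = {}"
  by (auto simp: restrict_word_def filter_empty_conv)

lemma count_list_restrict_word: "l \<in> A \<Longrightarrow> count_list (restrict_word A w) l = count_list w l"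
  by (induction w) auto

lemma one_le_count_list_iff: "1 \<le> count_list w l \<longleftrightarrow> l \<in> set w"
  by (metis One_nat_def Suc_leI count_list_0_iff neq0_conv not_one_le_zero)

lemma append_Cons_prefix_eq:
  assumes "xs @ a # us = ys @ a # vs" "a \<notin> set xs" "a \<notin> set ys"
  shows "xs = ys"
proof -
  have "takeWhile (\<lambda>l. l \<noteq> a) (zs @ a # ws) = zs" if "a \<notin> set zs" for zs ws
    using that by (induction zs) auto
  then show ?thesis using assms by metis
qed

lemma restrict_word_singleton: "restrict_word {l} w = replicate (count_list w l) l"
  by (induction w) auto

section \<open>The equational theory of the generating monoid and its isoterms\<close>

abbreviation S_equiv :: "word \<Rightarrow> word \<Rightarrow> bool" (infix "\<sim>\<^sub>S" 50) where
  "u \<sim>\<^sub>S v \<equiv> satisfies (S_monoid generating_word) (u, v)"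

lemma S_equiv_sym: "u \<sim>\<^sub>S v \<Longrightarrow> v \<sim>\<^sub>S u"
  and S_equiv_trans: "u \<sim>\<^sub>S v \<Longrightarrow> v \<sim>\<^sub>S w \<Longrightarrow> u \<sim>\<^sub>S w"
  by (auto simp: satisfies_def)

lemma L_equiv_imp_S_equiv: "u \<sim>\<^sub>L v \<Longrightarrow> u \<sim>\<^sub>S v"
  using satisfies_derivable[OF monoid_S_monoid] satisfies_L_identities by blast

lemma S_equiv_substitute: "u \<sim>\<^sub>S v \<Longrightarrow> substitute f u \<sim>\<^sub>S substitute f v"
  unfolding satisfies_S_monoid_iff substitute_substitute by blast

lemma S_equiv_removeAll:
  assumes "u \<sim>\<^sub>S v"
  shows "removeAll x u \<sim>\<^sub>S removeAll x v"
proof -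
  have "removeAll x w = substitute (\<lambda>l. if l = x then [] else [l]) w" for w
    by (induction w) auto
  then show ?thesis
    using S_equiv_substitute[OF assms] by simp
qed

text \<open>Erasing the letters outside \<open>A\<close> and renaming the others by \<open>g\<close>
  is a substitution. As its value at \<open>u\<close> is nonzero, \<open>v\<close> must have the
  same value, and injectivity of \<open>g\<close> removes the renaming.\<close>

lemma S_isoterm:
  assumes "u \<sim>\<^sub>S v" "inj_on g A" "sublist (map g (restrict_word A u)) generating_word"
  shows "restrict_word A v = restrict_word A u"
proof -
  have subst: "substitute (\<lambda>l. if l \<in> A then [g l] else []) w = map g (restrict_word A w)" for w
    by (induction w) auto
  have "map g (restrict_word A u) = map g (restrict_word A v)"
    using assms(1,3) unfolding satisfies_S_monoid_iff subst[symmetric] by blast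
  moreover have "inj_on g (set (restrict_word A u) \<union> set (restrict_word A v))"
    using assms(2) by (rule inj_on_subset) auto
  ultimately show ?thesis
    by (simp add: inj_on_map_eq_map)
qed

text \<open>Up to renaming, the pattern is the generating word \<open>xzxyty\<close> itself; the
  next three lemmas use its prefix \<open>xzxy\<close>, its suffix \<open>xyty\<close>, and its
  prefixes \<open>xz\<close> and \<open>xzx\<close>.\<close>

lemma S_isoterm_abacdc:
  assumes "u \<sim>\<^sub>S v" "distinct [a, b, c, d]" "restrict_word {a, b, c, d} u = [a, b, a, c, d, c]"
  shows "restrict_word {a, b, c, d} v = [a, b, a, c, d, c]"
proof -
  define g where "g l = (if l = a then X else if l = b then Z 0 else if l = c then Y else T 0)" for l
  show ?thesis
    unfolding assms(3)[symmetric]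
    by (rule S_isoterm[OF assms(1), of g])
      (use assms(2) in \<open>auto simp: assms(3) g_def inj_on_def sublist_code\<close>)
qed

lemma S_isoterm_abac:
  assumes "u \<sim>\<^sub>S v" "distinct [a, b, c]" "restrict_word {a, b, c} u = [a, b, a, c]"
  shows "restrict_word {a, b, c} v = [a, b, a, c]"
proof -
  define g where "g l = (if l = a then X else if l = b then Z 0 else Y)" for l
  show ?thesis
    unfolding assms(3)[symmetric]
    by (rule S_isoterm[OF assms(1), of g])
      (use assms(2) in \<open>auto simp: assms(3) g_def inj_on_def sublist_code\<close>)
qed

lemma S_isoterm_bcac:
  assumes "u \<sim>\<^sub>S v" "distinct [a, b, c]" "restrict_word {a, b, c} u = [b, c, a, c]"
  shows "restrict_word {a, b, c} v = [b, c, a, c]"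
proof -
  define g where "g l = (if l = c then Y else if l = b then X else T 0)" for l
  show ?thesis
    unfolding assms(3)[symmetric]
    by (rule S_isoterm[OF assms(1), of g])
      (use assms(2) in \<open>auto simp: assms(3) g_def inj_on_def sublist_code\<close>)
qed

lemma S_isoterm_two:
  assumes "u \<sim>\<^sub>S v" "a \<noteq> b" "restrict_word {a, b} u = w"
    and "w = [a, b] \<or> w = [a, b, a]"
  shows "restrict_word {a, b} v = w"
proof -
  define g where "g l = (if l = a then X else Z 0)" for l
  show ?thesis
    unfolding assms(3)[symmetric]
    by (rule S_isoterm[OF assms(1), of g])
      (use assms(2,4) in \<open>auto simp: assms(3) g_def inj_on_def sublist_code\<close>)
qed

text \<open>The empty word and a single letter are subwords of the generating word, hence isoterms;
  \<open>xx\<close> is not a subword, so the argument stops at one occurrence.\<close>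

lemma S_equiv_count_list:
  assumes "u \<sim>\<^sub>S v" "count_list u l \<le> 1"
  shows "count_list v l = count_list u l"
proof -
  have "restrict_word {l} v = restrict_word {l} u"
    by (rule S_isoterm[OF assms(1), of "\<lambda>_. X"])
      (use assms(2) in \<open>auto simp: restrict_word_singleton le_Suc_eq sublist_code\<close>)
  then show ?thesis
    by (simp add: restrict_word_singleton)
qed

section \<open>Words whose repeated letters are split\<close>

text \<open>The equation forces exactly two occurrences of \<open>x\<close> and one of
  \<open>t\<close>. Hence no letter of a \<open>reduced\<close> word occurs more than twice.\<close>

definition splits :: "letter \<Rightarrow> letter \<Rightarrow> word \<Rightarrow> bool" where
  "splits t x w \<longleftrightarrow> t \<noteq> x \<and> restrict_word {x, t} w = [x, t, x]"

definition reduced :: "word \<Rightarrow> bool" where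
  "reduced w \<longleftrightarrow> (\<forall>x. count_list w x \<le> 1 \<or> (\<exists>t. splits t x w))"

lemma splits_S_equiv: "splits t x u \<Longrightarrow> u \<sim>\<^sub>S v \<Longrightarrow> splits t x v"
  unfolding splits_def using S_isoterm_two[of u v x t "[x, t, x]"] by auto

lemma splits_count_list: "splits t x w \<Longrightarrow> count_list w x = 2 \<and> count_list w t = 1"
  unfolding splits_def
  using count_list_restrict_word[of x "{x, t}" w] count_list_restrict_word[of t "{x, t}" w] by auto

lemma reduced_S_equiv:
  assumes "reduced u" "u \<sim>\<^sub>S v"
  shows "reduced v"
  using assms S_equiv_count_list[of u v] splits_S_equiv unfolding reduced_def by metis

text \<open>Since \<open>xtx\<close> is an isoterm, a letter split in \<open>u\<close> is split by
  the same letter in \<open>v\<close> and occurs twice in both; the other letters occur at most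
  once.\<close>

lemma reduced_count_list:
  assumes "reduced u" "u \<sim>\<^sub>S v"
  shows "count_list v x = count_list u x"
  using assms S_equiv_count_list[of u v x] splits_S_equiv[of _ x u v] splits_count_list
  unfolding reduced_def by metis

text \<open>Three or more occurrences collapse by \<open>L_collect_three\<close>. If there are only
  two, a letter between them that occurs once in \<open>u\<close> would split \<open>x\<close>; so
  all letters of the gap are repeated, as \<open>L_collect_two\<close> requires.\<close>

lemma L_collect_unsplit:
  assumes "2 \<le> count_list u x" "\<nexists>t. splits t x u"
  shows "u \<sim>\<^sub>L [x, x] @ removeAll x u"
proof -
  have "x \<in> set u"
    using assms(1) by (metis count_list_0_iff not_numeral_le_zero)
  then obtain p w where u: "u = p @ x # w" and p: "x \<notin> set p"
    by (meson split_list_first)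
  have "x \<in> set w"
    using assms(1) p by (simp add: u flip: one_le_count_list_iff)
  then obtain q r where w: "w = q @ x # r" and q: "x \<notin> set q"
    by (meson split_list_first)
  show ?thesis
  proof (cases "x \<in> set r")
    case True
    then obtain r1 r2 where r: "r = r1 @ x # r2" by (meson split_list)
    have "u \<sim>\<^sub>L p @ [x, x] @ q @ r1 @ r2"
      using L_collect_three[of p "[x]" q r1 r2] by (simp add: u w r)
    also have "\<dots> \<sim>\<^sub>L [x, x] @ p @ q @ r1 @ r2"
      using L_square_central[of "[]" "[x]" p "q @ r1 @ r2"] by (simp add: derivable.sym)
    also have "\<dots> \<sim>\<^sub>L [x, x] @ removeAll x u"
      using L_square_absorbs[of x "p @ q @ r1 @ r2"] by (simp add: u w r)
    finally show ?thesis .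
  next
    case False
    have "2 \<le> count_list u y" if y: "y \<in> set q" for y
    proof (rule ccontr)
      assume "\<not> 2 \<le> count_list u y"
      moreover obtain q1 q2 where q12: "q = q1 @ y # q2"
        using y by (meson split_list)
      moreover have "x \<noteq> y" using y q by auto
      ultimately have "y \<notin> set p" "y \<notin> set q1" "y \<notin> set q2" "y \<notin> set r"
        by (auto simp: u w simp flip: one_le_count_list_iff)
      then have "restrict_word {x, y} p = []" "restrict_word {x, y} q1 = []"
        "restrict_word {x, y} q2 = []" "restrict_word {x, y} r = []"
        using p q False by (simp_all add: q12 restrict_word_eq_Nil_iff)
      then have "splits y x u"
        using \<open>x \<noteq> y\<close> by (simp add: splits_def u w q12)
      with assms(2) show False by blast
    qed
    then have "p @ [x] @ q @ [x] @ r \<sim>\<^sub>L [x, x] @ p @ q @ r"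
      by (intro L_collect_two) (auto simp: u w)
    then show ?thesis
      using p q False by (simp add: u w)
  qed
qed

text \<open>
  If \<open>d\<close> and \<open>c\<close> are not both first or both second occurrences of repeated letters, then \<open>d\<close> and \<open>c\<close>,
  together with the letters that split them, form a word of one of the shapes \<open>ab\<close>, \<open>aba\<close>, \<open>abac\<close>,
  \<open>bcac\<close>, \<open>abacdc\<close>. These are isoterms, so \<open>v\<close> would have \<open>d\<close> and \<open>c\<close> in the same order as \<open>u\<close>.
\<close>

lemma reduced_swap:
  assumes uv: "A @ d # c # B \<sim>\<^sub>S P @ c # s" and A: "A = P @ p" and c_p: "c \<notin> set p"
    and dc: "d \<noteq> c" and red: "reduced (P @ c # s)"
  shows "A @ d # c # B \<sim>\<^sub>L A @ c # d # B"
proof -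
  let ?u = "A @ d # c # B" and ?v = "P @ c # s"
  have red_u: "reduced ?u"
    using red S_equiv_sym[OF uv] by (rule reduced_S_equiv)
  have count_le: "count_list ?u x \<le> 2" for x
    using red_u splits_count_list unfolding reduced_def by (metis le_SucI numeral_2_eq_2 One_nat_def order_refl)
  have split_u: "\<exists>t. splits t x ?u" if "2 \<le> count_list ?u x" for x
    using red_u that unfolding reduced_def by (metis Suc_1 not_less_eq_eq)
  have c_AP: "c \<in> set A \<longleftrightarrow> c \<in> set P"
    using A c_p by auto
  have P_A: "set P \<subseteq> set A" and count_P: "count_list P x \<le> count_list A x" for x
    using A by auto
  \<comment> \<open>Here the marked \<open>c\<close> is the first of two, so the letter that splits
    \<open>c\<close> lies in \<open>B\<close>.\<close>
  have c_split: "\<exists>t. t \<noteq> c \<and> t \<noteq> d \<and> t \<notin> set A \<and> restrict_word {c, t} B = [t, c]"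
    if "c \<notin> set A" "c \<in> set B"
  proof -
    have "2 \<le> count_list ?u c"
      using that(2)[folded one_le_count_list_iff] by simp
    then obtain t where t: "t \<noteq> c" "restrict_word {c, t} ?u = [c, t, c]"
      using split_u unfolding splits_def by blast
    have "restrict_word {c, t} A = []"
    proof (cases "restrict_word {c, t} A")
      case (Cons l w)
      then have "l = c" using t(2) by simp
      with Cons that(1) show ?thesis
        by (metis IntD1 list.set_intros(1) restrict_word_simps(4))
    qed
    with t dc show ?thesis
      by (intro exI[of _ t]) (auto simp: restrict_word_eq_Nil_iff split: if_splits)
  qed
  \<comment> \<open>Only the first two cases can occur. In the others an isoterm would keep the
    marked \<open>d\<close> before the marked \<open>c\<close>, but in \<open>v\<close> the prefix
    \<open>P\<close> is too short to contain that \<open>d\<close>.\<close>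
  consider (second) "d \<in> set A" "c \<in> set A"
    | (first) "d \<notin> set A" "c \<notin> set A" "d \<in> set B" "c \<in> set B"
    | (d_second) "d \<in> set A" "c \<notin> set A"
    | (c_second) "d \<notin> set A" "c \<in> set A"
    | (c_first) "d \<notin> set A" "c \<notin> set A" "d \<notin> set B" "c \<in> set B"
    | (d_first) "d \<notin> set A" "c \<notin> set A" "c \<notin> set B"
    by blast
  then show ?thesis
  proof cases
    \<comment> \<open>The direction in which \<open>L_swap_second\<close> is used depends on which
      letter occurs first in \<open>A\<close>; in the next case, the order of the second occurrences
      in \<open>B\<close> decides likewise.\<close>
    case second
    then obtain A1 A2 where A12: "A = A1 @ d # A2" by (meson split_list)
    then consider "c \<in> set A2" | "c \<in> set A1"
      using second dc by auto
    then show ?thesis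
    proof cases
      case 1
      then obtain A3 A4 where "A2 = A3 @ c # A4" by (meson split_list)
      then show ?thesis
        using L_swap_second[of A1 "[d]" A3 "[c]" A4 B] by (simp add: A12)
    next
      case 2
      then obtain A3 A4 where "A1 = A3 @ c # A4" by (meson split_list)
      then show ?thesis
        using L_swap_second[of A3 "[c]" A4 "[d]" A2 B] by (simp add: A12 derivable.sym)
    qed
  next
    case first
    then obtain B1 B2 where B12: "B = B1 @ d # B2" by (meson split_list)
    then consider "c \<in> set B2" | "c \<in> set B1"
      using first dc by auto
    then show ?thesis
    proof cases
      case 1
      then obtain B3 B4 where "B2 = B3 @ c # B4" by (meson split_list)
      then show ?thesis
        using L_swap_first[of A "[d]" "[c]" B1 B3 B4] by (simp add: B12)
    next
      case 2
      then obtain B3 B4 where "B1 = B3 @ c # B4" by (meson split_list)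
      then show ?thesis
        using L_swap_first[of A "[c]" "[d]" B3 B4 B2] by (simp add: B12 derivable.sym)
    qed
  next
    case d_second
    have "2 \<le> count_list ?u d"
      using d_second(1)[folded one_le_count_list_iff] by simp
    then obtain t where t: "t \<noteq> d" "restrict_word {d, t} ?u = [d, t, d]"
      using split_u unfolding splits_def by blast
    then have tA: "restrict_word {d, t} A = [d, t]" and tB: "restrict_word {d, t} (c # B) = []"
      using d_second(1) restrict_word_eq_Nil_iff[of "{d, t}" A]
      by (auto simp: append_eq_Cons_conv split: if_splits)
    have ct: "c \<noteq> t" "t \<notin> set B" "d \<notin> set B"
      using tB by (auto simp: restrict_word_eq_Nil_iff split: if_splits)
    have "t \<in> set A"
      using tA by (metis IntD1 list.set_intros(1,2) restrict_word_simps(4))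
    have "count_list A d = 1"
      using count_list_restrict_word[of d "{d, t}" A] t(1) by (simp add: tA)
    \<comment> \<open>If \<open>d t d\<close> preceded the first \<open>c\<close> of
      \<open>v\<close>, then \<open>P\<close> would contain two \<open>d\<close>, while
      \<open>A\<close> has only one.\<close>
    have contradiction: False if "restrict_word D ?v = [d, t, d] @ c # w" "c \<in> D" "d \<in> D" for D w
    proof -
      have "restrict_word D P = [d, t, d]"
      proof (rule append_Cons_prefix_eq)
        show "restrict_word D P @ c # restrict_word D s = [d, t, d] @ c # w"
          using that by simp
      qed (use ct dc d_second(2) c_AP in auto)
      then have "count_list P d = 2"
        using count_list_restrict_word[OF \<open>d \<in> D\<close>, of P] t(1) by simp
      then show False
        using \<open>count_list A d = 1\<close> count_P[of d] by simp
    qed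
    have False
    proof (cases "c \<in> set B")
      case False
      have "restrict_word {d, t, c} A = restrict_word {d, t} A"
        by (rule restrict_word_cong) (use d_second in auto)
      moreover have "restrict_word {d, t, c} B = []"
        using False ct by (simp add: restrict_word_eq_Nil_iff)
      ultimately have "restrict_word {d, t, c} ?u = [d, t, d, c]"
        by (simp add: tA)
      from S_isoterm_abac[OF uv _ this] have "restrict_word {d, t, c} ?v = [d, t, d] @ c # []"
        using t ct dc by simp
      then show False by (rule contradiction) auto
    next
      case True
      then obtain r where r: "r \<noteq> c" "r \<noteq> d" "r \<notin> set A" "restrict_word {c, r} B = [r, c]"
        using c_split d_second(2) by blast
      have "restrict_word {d, t, c, r} A = restrict_word {d, t} A"
        by (rule restrict_word_cong) (use d_second r in auto)
      moreover have "restrict_word {d, t, c, r} B = restrict_word {c, r} B"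
        by (rule restrict_word_cong) (use ct in auto)
      ultimately have "restrict_word {d, t, c, r} ?u = [d, t, d, c, r, c]"
        by (simp add: tA r)
      moreover have "r \<noteq> t" using r(3) \<open>t \<in> set A\<close> by auto
      ultimately have "restrict_word {d, t, c, r} ?v = [d, t, d] @ c # [r, c]"
        using S_isoterm_abacdc[OF uv, of d t c r] t ct dc r by simp
      then show False by (rule contradiction) auto
    qed
    then show ?thesis ..
  next
    case c_second
    have d_P: "d \<notin> set P" and c_P: "c \<in> set P"
      using c_second P_A c_AP by auto
    have False
    proof (cases "d \<in> set B")
      case True
      have "2 \<le> count_list ?v c"
        using c_P[folded one_le_count_list_iff] by simp
      then obtain z where z: "z \<noteq> c" "restrict_word {c, z} ?v = [c, z, c]"
        using red unfolding reduced_def splits_def by (metis Suc_1 not_less_eq_eq)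
      then have zP: "restrict_word {c, z} P = [c, z]" and zs: "restrict_word {c, z} s = []"
        using c_P restrict_word_eq_Nil_iff[of "{c, z}" P]
        by (auto simp: append_eq_Cons_conv split: if_splits)
      have "2 \<le> count_list ?u d"
        using True[folded one_le_count_list_iff] by simp
      then obtain t where "splits t d ?u"
        using split_u by blast
      from splits_S_equiv[OF this uv]
      have t: "t \<noteq> d" "restrict_word {d, t} ?v = [d, t, d]"
        by (simp_all add: splits_def)
      have tP: "restrict_word {d, t} P = []"
      proof (cases "restrict_word {d, t} P")
        case (Cons l w)
        then have "l = d" using t(2) by simp
        with Cons d_P show ?thesis
          by (metis IntD1 list.set_intros(1) restrict_word_simps(4))
      qed
      with t dc have ct: "c \<noteq> t" and ts: "restrict_word {d, t} s = [d, t, d]"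
        by (auto split: if_splits)
      have "z \<in> set P"
        using zP by (metis IntD1 list.set_intros(1,2) restrict_word_simps(4))
      then have zt: "z \<noteq> t" "z \<noteq> d"
        using tP d_P by (auto simp: restrict_word_eq_Nil_iff)
      have "restrict_word {c, z, d, t} P = restrict_word {c, z} P"
        by (rule restrict_word_cong) (use tP in \<open>auto simp: restrict_word_eq_Nil_iff\<close>)
      moreover have "restrict_word {c, z, d, t} s = restrict_word {d, t} s"
        by (rule restrict_word_cong) (use zs in \<open>auto simp: restrict_word_eq_Nil_iff\<close>)
      ultimately have "restrict_word {c, z, d, t} ?v = [c, z, c, d, t, d]"
        by (simp add: zP ts)
      \<comment> \<open>The isoterm is transferred from \<open>v\<close> to \<open>u\<close>: in
        \<open>v\<close> all of \<open>c z c\<close> precedes \<open>d t d\<close>, but in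
        \<open>u\<close> the marked \<open>d\<close> precedes the marked \<open>c\<close>.\<close>
      then have "restrict_word {c, z, d, t} ?u = [c, z, c] @ d # [t, d]"
        using S_isoterm_abacdc[OF S_equiv_sym[OF uv], of c z d t] z(1) t(1) ct zt dc by simp
      then have u: "restrict_word {c, z, d, t} A @ d # c # restrict_word {c, z, d, t} B =
          [c, z, c] @ d # [t, d]"
        by simp
      then have "restrict_word {c, z, d, t} A = [c, z, c]"
        by (rule append_Cons_prefix_eq) (use c_second(1) dc zt in auto)
      with u ct show False by simp
    next
      case False
      have count: "count_list A c = 1" "count_list B c = 0"
        using count_le[of c] c_second(2)[folded one_le_count_list_iff] dc by simp_all
      have "restrict_word {c, d} A = restrict_word {c} A"
        by (rule restrict_word_cong) (use c_second in auto)
      moreover have "restrict_word {c, d} B = []"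
        using False count by (auto simp: restrict_word_eq_Nil_iff count_list_0_iff)
      ultimately have "restrict_word {c, d} ?u = [c, d, c]"
        by (simp add: restrict_word_singleton count)
      then have "restrict_word {c, d} ?v = [c, d, c]"
        using S_isoterm_two[OF uv, of c d] dc by simp
      moreover have "restrict_word {c, d} P = restrict_word {c} P"
        by (rule restrict_word_cong) (use d_P in auto)
      moreover obtain k where "count_list P c = Suc k"
        using c_P by (metis count_list_0_iff not0_implies_Suc)
      ultimately show False
        using dc by (cases k) (auto simp: restrict_word_singleton)
    qed
    then show ?thesis ..
  next
    case c_first
    obtain r where r: "r \<noteq> c" "r \<noteq> d" "r \<notin> set A" "restrict_word {c, r} B = [r, c]"
      using c_split c_first by blast
    have "restrict_word {r, d, c} A = []"
      using c_first r by (simp add: restrict_word_eq_Nil_iff)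
    moreover have "restrict_word {r, d, c} B = restrict_word {c, r} B"
      by (rule restrict_word_cong) (use c_first in auto)
    ultimately have "restrict_word {r, d, c} ?u = [d, c, r, c]"
      by (simp add: r)
    then have "restrict_word {r, d, c} ?v = [d, c, r, c]"
      using S_isoterm_bcac[OF uv, of r d c] r dc by simp
    moreover have "restrict_word {r, d, c} P = []"
      using c_first r P_A by (auto simp: restrict_word_eq_Nil_iff)
    ultimately show ?thesis using dc by simp
  next
    case d_first
    have "restrict_word {d, c} A = []" "restrict_word {d, c} P = []"
      using d_first P_A by (auto simp: restrict_word_eq_Nil_iff)
    moreover have "restrict_word {d, c} B = restrict_word {d} B"
      by (rule restrict_word_cong) (use d_first in auto)
    moreover have "count_list B d \<le> 1"
      using count_le[of d] dc by (auto split: if_splits)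
    ultimately have "restrict_word {d, c} ?u = [d, c] \<or> restrict_word {d, c} ?u = [d, c, d]"
      by (auto simp: restrict_word_singleton le_Suc_eq)
    then have "restrict_word {d, c} ?v = [d, c] \<or> restrict_word {d, c} ?v = [d, c, d]"
      using S_isoterm_two[OF uv, of d c] dc by blast
    then show ?thesis
      using \<open>restrict_word {d, c} P = []\<close> dc by auto
  qed
qed

text \<open>Letter-by-letter sorting: the first occurrence in \<open>u\<close> of the next letter
  \<open>c\<close> of \<open>v\<close> is moved to the front of \<open>u\<close> and then joins the
  common prefix \<open>P\<close>.\<close>

lemma L_equiv_reduced:
  assumes "P @ u \<sim>\<^sub>S P @ v" "reduced (P @ v)"
  shows "P @ u \<sim>\<^sub>L P @ v"
  using assms
proof (induction v arbitrary: P u)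
  case Nil
  have "count_list u x = 0" for x
    using reduced_count_list[OF Nil(2) S_equiv_sym[OF Nil(1)], of x] by simp
  then have "u = []"
    by (metis count_list_0_iff list.set_intros(1) neq_Nil_conv)
  then show ?case by (simp add: derivable.refl)
next
  case (Cons c v)
  have "count_list u c = count_list (c # v) c"
    using reduced_count_list[OF Cons.prems(2) S_equiv_sym[OF Cons.prems(1)], of c] by simp
  then have "c \<in> set u"
    by (simp flip: one_le_count_list_iff)
  then obtain p q where u: "u = p @ c # q" and c_p: "c \<notin> set p"
    by (meson split_list_first)
  \<comment> \<open>The letter \<open>c\<close> passes the letters of \<open>p\<close> from right to
    left. Each swap is sound, so the word stays equivalent to the target and
    \<open>reduced_swap\<close> applies again.\<close>
  have move: "P @ p @ c # q \<sim>\<^sub>L P @ c # p @ q"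
    if "c \<notin> set p" "P @ p @ c # q \<sim>\<^sub>S P @ c # v" for p q
    using that
  proof (induction p arbitrary: q rule: rev_induct)
    case Nil
    then show ?case by (simp add: derivable.refl)
  next
    case (snoc d p)
    have step: "(P @ p) @ d # c # q \<sim>\<^sub>L (P @ p) @ c # d # q"
      by (rule reduced_swap[OF _ HOL.refl]) (use snoc.prems Cons.prems in auto)
    have "(P @ p) @ c # d # q \<sim>\<^sub>S P @ c # v"
      using S_equiv_trans[OF S_equiv_sym[OF L_equiv_imp_S_equiv[OF step]]] snoc.prems by simp
    then have "P @ p @ c # d # q \<sim>\<^sub>L P @ c # p @ d # q"
      using snoc.IH[of "d # q"] snoc.prems by simp
    with step show ?case
      using derivable.trans by fastforce
  qed
  have first: "P @ u \<sim>\<^sub>L P @ c # p @ q"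
    using move c_p Cons.prems(1) by (simp add: u)
  have "(P @ [c]) @ (p @ q) \<sim>\<^sub>S (P @ [c]) @ v"
    using S_equiv_trans[OF S_equiv_sym[OF L_equiv_imp_S_equiv[OF first]] Cons.prems(1)] by simp
  then have "(P @ [c]) @ (p @ q) \<sim>\<^sub>L (P @ [c]) @ v"
    using Cons.prems(2) by (intro Cons.IH) simp_all
  with first show ?case
    using derivable.trans by fastforce
qed

text \<open>Completeness of the identities of \<open>L\<close>, by induction on length. Erasing an
  unsplit \<open>x\<close> is a substitution, so it leaves shorter equivalent words; the same factor
  \<open>xx\<close> is then put in front of both.\<close>

lemma S_equiv_imp_L_equiv:
  assumes "u \<sim>\<^sub>S v"
  shows "u \<sim>\<^sub>L v"
  using assms
proof (induction "length u" arbitrary: u v rule: less_induct)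
  case less
  show ?case
  proof (cases "reduced u")
    case True
    then have "reduced v"
      using less.prems by (rule reduced_S_equiv)
    then show ?thesis
      using L_equiv_reduced[of "[]" u v] less.prems by simp
  next
    case False
    then obtain x where xu: "2 \<le> count_list u x" "\<nexists>t. splits t x u"
      unfolding reduced_def by (metis Suc_1 not_less_eq_eq)
    have xv: "2 \<le> count_list v x" "\<nexists>t. splits t x v"
      using xu S_equiv_count_list[OF S_equiv_sym[OF less.prems], of x]
        splits_S_equiv[OF _ S_equiv_sym[OF less.prems]] by force+
    have "x \<in> set u"
      using xu(1) by (metis count_list_0_iff not_numeral_le_zero)
    then have "length (removeAll x u) < length u"
      by (rule length_removeAll_less)
    from less.hyps[OF this S_equiv_removeAll[OF less.prems]]
    have "[x, x] @ removeAll x u \<sim>\<^sub>L [x, x] @ removeAll x v"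
      using derivable_context[of L_identities _ _ "[x, x]" "[]"] by simp
    with L_collect_unsplit[OF xu] L_collect_unsplit[OF xv] show ?thesis
      by (meson derivable.sym derivable.trans)
  qed
qed

theorem lemma4p6:
  shows "(L_variety :: 'a monoid set) = var_monoid (S_monoid [X, Z 0, X, Y, T 0, Y])"
proof (intro equalityI subsetI)
  fix N :: "'a monoid"
  assume "N \<in> L_variety"
  then have N: "monoid N" "\<forall>e\<in>L_identities. satisfies N e"
    by (auto simp: L_variety_def var_identities_def)
  show "N \<in> var_monoid (S_monoid generating_word)"
  \<comment> \<open>By completeness, each identity of the generating monoid is derivable and
    therefore holds in \<open>N\<close>.\<close>
  proof (rule var_monoidI[OF monoid_S_monoid N(1)])
    fix e :: "word \<times> word"
    assume "satisfies (S_monoid generating_word) e"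
    then have "fst e \<sim>\<^sub>L snd e"
      by (intro S_equiv_imp_L_equiv) simp
    from satisfies_derivable[OF N this] show "satisfies N e" by simp
  qed
next
  fix N :: "'a monoid"
  assume "N \<in> var_monoid (S_monoid generating_word)"
  then obtain I :: "('a \<Rightarrow> word set) set" where N: "monoid N"
    "image_of_submonoid_of_power I (S_monoid generating_word) N"
    by (auto simp: var_monoid_def)
  have "satisfies N e" if "e \<in> L_identities" for e
    using satisfies_image_of_submonoid_of_power[OF monoid_S_monoid N] satisfies_L_identities[OF that] .
  with N(1) show "N \<in> L_variety"
    by (simp add: L_variety_def var_identities_def)
qed

end
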